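(* Let $q>0$, and let $x_0=x_0(q)$ be the unique positive zero of the $q$-digamma function $\psi_q$. Then the function $x\mapsto\frac{1}{\psi_{q}(x)}$ is logarithmically completely monotonic on $(x_{0},\infty)$.
   Context: For $x>0$ the $q$-gamma function is $$\Gamma_q(x)=(1-q)^{1-x}\prod_{j=0}^{\infty}\frac{1-q^{j+1}}{1-q^{j+x}}\quad (0<q<1),$$ $$\Gamma_q(x)=(q-1)^{1-x}q^{\frac{x(x-1)}{2}}\prod_{j=0}^{\infty}\frac{1-q^{-(j+1)}}{1-q^{-(j+x)}}\quad (q>1),$$ and for $q=1$ it is understood as the limit as $q\to 1$, i.e. $\Gamma_1=\Gamma$ (Euler's gamma function). The $q$-digamma function is $\psi_q(x)=\Gamma_q'(x)/\Gamma_q(x)$ for $x>0$. It is known that for each $q>0$ the function $\psi_q$ has a uniquely determined positive zero, denoted $x_0=x_0(q)$, and $x_0\in(1,2)$. A positive function $f$ is logarithmically completely monotonic on an interval $I$ if it has derivatives of all orders on $I$ and $(-1)^n\left(\ln f\right)^{(n)}(x)\geq 0$ for all $x\in I$ and all positive integers $n$. *)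

theory Defs
  imports "HOL-Analysis.Analysis"
begin

(* Only meaningful for q > 0 and x > 0, where both products converge to nonzero limits. *)
definition q_Gamma :: "real \<Rightarrow> real \<Rightarrow> real" where
  "q_Gamma q x =
     (if q < 1 then
        (1 - q) powr (1 - x) *
        (\<Prod>j. (1 - q powr (real j + 1)) / (1 - q powr (real j + x)))
      else if q > 1 then
        (q - 1) powr (1 - x) * q powr (x * (x - 1) / 2) *
        (\<Prod>j. (1 - q powr (- (real j + 1))) / (1 - q powr (- (real j + x))))
      else Gamma x)"

definition q_digamma :: "real \<Rightarrow> real \<Rightarrow> real" where
  "q_digamma q x = deriv (q_Gamma q) x / q_Gamma q x"

definition q_digamma_zero :: "real \<Rightarrow> real" where
  "q_digamma_zero q = (THE x. x > 0 \<and> q_digamma q x = 0)"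

(* Derivatives are two-sided, so the interval I is meant to be open. *)
definition log_completely_monotonic_on :: "(real \<Rightarrow> real) \<Rightarrow> real set \<Rightarrow> bool" where
  "log_completely_monotonic_on f I \<longleftrightarrow>
     (\<forall>x\<in>I. f x > 0) \<and>
     (\<forall>n. \<forall>x\<in>I. ((deriv ^^ n) f) differentiable (at x)) \<and>
     (\<forall>n\<ge>1. \<forall>x\<in>I. (- 1) ^ n * (deriv ^^ n) (\<lambda>t. ln (f t)) x \<ge> 0)"

end

theory Submission
  imports Defs
begin

text \<open>
  Write \<open>\<psi>\<close> for the \<open>q\<close>-digamma function. Its derivative \<open>\<theta>\<close> is completely monotonic and positive on
  the positive axis, and everything else follows from that. As \<open>\<theta> > 0\<close>, \<open>\<psi>\<close> is strictly increasing, so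
  it has at most one zero; it has one in \<open>(1, 2)\<close> because \<open>ln \<Gamma>\<^sub>q\<close> takes the same value at \<open>1\<close> and \<open>2\<close>.
  To the right of the zero \<open>\<psi>\<close> is positive, and there \<open>u = 1 / \<psi>\<close> satisfies \<open>- u' = \<theta> u u\<close>. Since
  completely monotonic functions are closed under products, this equation improves the order up to
  which the derivatives of \<open>u\<close> are known to alternate in sign by one each time it is used
  (\<open>cm_upto_inverse\<close>), so \<open>u\<close> is completely monotonic. Finally \<open>- (ln u)' = \<theta> u\<close> is a product of two
  completely monotonic functions, which is the claim (\<open>log_cm_inverse_digamma\<close>).

  It remains to find \<open>\<theta>\<close>. For \<open>q = 1\<close> it is the trigamma function. For \<open>q \<noteq> 1\<close> let \<open>p\<close> be the one of
  \<open>q\<close> and \<open>1 / q\<close> that is below \<open>1\<close>. The power series \<open>G y = (\<Sum>k\<ge>1. y ^ k / (k * (1 - p ^ k)))\<close> satisfies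
  \<open>G y - G (p * y) = - ln (1 - y)\<close>, so the infinite product telescopes to
  \<open>exp (G (p powr x) - G p)\<close> (\<open>q_product\<close>). The remaining factors of \<open>\<Gamma>\<^sub>q\<close> contribute to \<open>ln \<Gamma>\<^sub>q\<close> a
  polynomial in \<open>x\<close> of degree at most two whose second derivative is \<open>0\<close> or \<open>ln q\<close>, so \<open>\<theta>\<close> is a
  nonnegative constant plus a power series in \<open>p powr x\<close> with nonnegative coefficients; and
  such series are completely monotonic in \<open>x\<close>, because \<open>- d/dx\<close> multiplies the \<open>k\<close>-th coefficient by
  \<open>- ln p * k\<close>.
\<close>

section \<open>Completely monotonic functions\<close>

text \<open>
  Complete monotonicity truncated at order \<open>n\<close>. The truncation is what makes inductions possible in
  which a function occurs in the formula for its own derivative, and phrasing it through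
  successive witnesses \<open>g\<close> for \<open>- f'\<close> replaces the Leibniz rule by the plain product rule.
\<close>

primrec cm_upto :: "nat \<Rightarrow> real set \<Rightarrow> (real \<Rightarrow> real) \<Rightarrow> bool" where
  "cm_upto 0 I f \<longleftrightarrow> (\<forall>x\<in>I. 0 \<le> f x)"
| "cm_upto (Suc n) I f \<longleftrightarrow> (\<forall>x\<in>I. 0 \<le> f x) \<and>
     (\<exists>g. (\<forall>x\<in>I. (f has_real_derivative - g x) (at x)) \<and> cm_upto n I g)"

lemma cm_upto_nonneg: "cm_upto n I f \<Longrightarrow> x \<in> I \<Longrightarrow> 0 \<le> f x"
  by (cases n) auto

lemma cm_upto_Suc_imp: "cm_upto (Suc n) I f \<Longrightarrow> cm_upto n I f"
proof (induction n arbitrary: f)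
  case (Suc n)
  then obtain g where "\<forall>x\<in>I. (f has_real_derivative - g x) (at x)" "cm_upto (Suc n) I g"
    by auto
  with Suc show ?case by auto
qed simp

lemma cm_upto_subset: "cm_upto n I f \<Longrightarrow> J \<subseteq> I \<Longrightarrow> cm_upto n J f"
proof (induction n arbitrary: f)
  case (Suc n)
  then obtain g where "\<forall>x\<in>I. (f has_real_derivative - g x) (at x)" "cm_upto n I g"
    by auto
  with Suc show ?case by (auto intro!: exI[of _ g])
qed auto

lemma cm_upto_const: "0 \<le> c \<Longrightarrow> cm_upto n I (\<lambda>x. c)"
proof (induction n arbitrary: c)
  case (Suc n)
  then show ?case by (auto intro!: exI[of _ "\<lambda>x. 0"])
qed auto

lemma cm_upto_add: "cm_upto n I f \<Longrightarrow> cm_upto n I g \<Longrightarrow> cm_upto n I (\<lambda>x. f x + g x)"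
proof (induction n arbitrary: f g)
  case (Suc n)
  from Suc.prems obtain f' g' where
    "\<And>x. x \<in> I \<Longrightarrow> (f has_real_derivative - f' x) (at x)" "cm_upto n I f'"
    "\<And>x. x \<in> I \<Longrightarrow> (g has_real_derivative - g' x) (at x)" "cm_upto n I g'"
    by (metis cm_upto.simps(2))
  then show ?case
    using Suc by (auto intro!: exI[of _ "\<lambda>x. f' x + g' x"] derivative_eq_intros)
qed auto

lemma cm_upto_mult: "cm_upto n I f \<Longrightarrow> cm_upto n I g \<Longrightarrow> cm_upto n I (\<lambda>x. f x * g x)"
proof (induction n arbitrary: f g)
  case (Suc n)
  from Suc.prems obtain f' g' where
    d: "\<And>x. x \<in> I \<Longrightarrow> (f has_real_derivative - f' x) (at x)" "cm_upto n I f'"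
       "\<And>x. x \<in> I \<Longrightarrow> (g has_real_derivative - g' x) (at x)" "cm_upto n I g'"
    by (metis cm_upto.simps(2))
  have "cm_upto n I (\<lambda>x. f' x * g x + f x * g' x)"
    using d Suc.prems[THEN cm_upto_Suc_imp] by (intro cm_upto_add Suc.IH)
  moreover have "((\<lambda>x. f x * g x) has_real_derivative - (f' x * g x + f x * g' x)) (at x)"
    if "x \<in> I" for x
    using d(1,3)[OF that] by (auto intro!: derivative_eq_intros)
  ultimately show ?case
    using Suc.prems by (auto intro!: exI[of _ "\<lambda>x. f' x * g x + f x * g' x"])
qed auto

text \<open>
  The equation \<open>- (1 / g)' = g' * (1 / g) * (1 / g)\<close> has only \<open>1 / g\<close> itself and \<open>g'\<close> on its right-hand
  side, so the order reached for \<open>1 / g\<close> grows by one with each use.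
\<close>

lemma cm_upto_inverse:
  assumes pos: "\<And>x. x \<in> I \<Longrightarrow> 0 < g x"
    and deriv: "\<And>x. x \<in> I \<Longrightarrow> (g has_real_derivative g' x) (at x)"
    and cm: "\<And>n. cm_upto n I g'"
  shows "cm_upto n I (\<lambda>x. 1 / g x)"
proof (induction n)
  case 0
  then show ?case using pos by (auto simp: less_imp_le)
next
  case (Suc n)
  have "cm_upto n I (\<lambda>x. g' x * (1 / g x * (1 / g x)))"
    by (intro cm_upto_mult Suc cm)
  moreover have "((\<lambda>x. 1 / g x) has_real_derivative - (g' x * (1 / g x * (1 / g x)))) (at x)"
    if "x \<in> I" for x
    using pos[OF that] deriv[OF that]
    by (auto intro!: derivative_eq_intros simp: field_simps)
  ultimately show ?case
    using pos by (auto intro!: exI[of _ "\<lambda>x. g' x * (1 / g x * (1 / g x))"] simp: less_imp_le)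
qed

text \<open>
  The passage from witnesses to iterated derivatives. The factor \<open>c\<close> absorbs the sign that each
  derivative introduces, and \<open>h\<close> is allowed to differ from \<open>c * f\<close> off \<open>I\<close>, because only there is
  \<open>deriv\<close> under control.
\<close>

lemma cm_upto_iterated_deriv:
  assumes "open I" "cm_upto n I f" "\<And>x. x \<in> I \<Longrightarrow> h x = c * f x" "k \<le> n" "x \<in> I"
  shows "0 \<le> c * (- 1) ^ k * (deriv ^^ k) h x"
    and "k < n \<Longrightarrow> (deriv ^^ k) h differentiable (at x)"
proof -
  have "0 \<le> c * (- 1) ^ k * (deriv ^^ k) h x \<and>
      (k < n \<longrightarrow> (deriv ^^ k) h differentiable (at x))"
    using assms
  proof (induction k arbitrary: n f h c)
    case 0
    have "0 \<le> c * c * f x"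
      using 0 by (simp add: cm_upto_nonneg)
    moreover have "h differentiable (at x)" if "0 < n"
    proof -
      obtain m where m: "n = Suc m" using \<open>0 < n\<close> gr0_conv_Suc by blast
      obtain g where g: "(f has_real_derivative - g x) (at x)"
        using 0 m by auto
      have "((\<lambda>x. c * f x) has_real_derivative c * - g x) (at x)"
        by (intro DERIV_cmult g)
      then have "(h has_real_derivative c * - g x) (at x)"
        by (rule has_field_derivative_transform_within_open[OF _ 0(1,5)]) (use 0 in auto)
      then show ?thesis by (auto simp: real_differentiable_def)
    qed
    ultimately show ?case using 0 by (simp add: mult.assoc)
  next
    case (Suc k)
    obtain m where m: "n = Suc m" using Suc.prems by (cases n) auto
    obtain g where g: "\<And>y. y \<in> I \<Longrightarrow> (f has_real_derivative - g y) (at y)" "cm_upto m I g"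
      using Suc.prems m by auto
    have "deriv h y = - c * g y" if "y \<in> I" for y
    proof -
      have "((\<lambda>x. c * f x) has_real_derivative c * - g y) (at y)"
        by (intro DERIV_cmult g that)
      then have "(h has_real_derivative c * - g y) (at y)"
        by (rule has_field_derivative_transform_within_open[OF _ Suc.prems(1) that]) (use Suc.prems in auto)
      then show ?thesis by (simp add: DERIV_imp_deriv)
    qed
    from Suc.IH[OF Suc.prems(1) g(2) this] Suc.prems m
    show ?case by (simp add: funpow_Suc_right del: funpow.simps)
  qed
  then show "0 \<le> c * (- 1) ^ k * (deriv ^^ k) h x"
    and "k < n \<Longrightarrow> (deriv ^^ k) h differentiable (at x)" by auto
qed

section \<open>Reciprocals of digamma-like functions\<close>

text \<open>
  The assumptions isolate what the three ranges of \<open>q\<close> have in common, \<open>Q\<close> being \<open>ln \<Gamma>\<^sub>q\<close>. The mean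
  value theorem for \<open>Q\<close> on \<open>[1, 2]\<close> produces the zero, so its existence takes no estimate of \<open>\<psi>\<close>.
\<close>

lemma log_cm_inverse_digamma:
  assumes Gamma: "\<And>x. 0 < x \<Longrightarrow> q_Gamma q x = exp (Q x)"
    and Q: "\<And>x. 0 < x \<Longrightarrow> (Q has_real_derivative \<psi> x) (at x)"
    and \<psi>: "\<And>x. 0 < x \<Longrightarrow> (\<psi> has_real_derivative \<theta> x) (at x)"
    and cm: "\<And>n. cm_upto n {0<..} \<theta>"
    and pos: "\<And>x. 0 < x \<Longrightarrow> 0 < \<theta> x"
    and "Q 1 = Q 2"
  shows "log_completely_monotonic_on (\<lambda>x. 1 / q_digamma q x) {q_digamma_zero q<..}"
proof -
  have digamma: "q_digamma q x = \<psi> x" if "0 < x" for x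
  proof -
    have "((\<lambda>x. exp (Q x)) has_real_derivative exp (Q x) * \<psi> x) (at x)"
      using Q[OF that] by (auto intro!: derivative_eq_intros)
    then have "(q_Gamma q has_real_derivative exp (Q x) * \<psi> x) (at x)"
      by (rule has_field_derivative_transform_within_open[where S = "{0<..}"]) (use that Gamma in auto)
    then show ?thesis
      using that by (simp add: q_digamma_def Gamma DERIV_imp_deriv)
  qed
  have mono: "\<psi> x < \<psi> y" if "0 < x" "x < y" for x y
    using that by (intro DERIV_pos_imp_increasing[of x y \<psi>]) (auto intro!: exI \<psi> pos)
  obtain z where z: "1 < z" "\<psi> z = 0"
    using MVT2[of 1 2 Q \<psi>] Q \<open>Q 1 = Q 2\<close> by force
  have "q_digamma_zero q = z"
    unfolding q_digamma_zero_def
  proof (rule the_equality)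
    show "0 < z \<and> q_digamma q z = 0" using z by (simp add: digamma)
    show "x = z" if "0 < x \<and> q_digamma q x = 0" for x
      using that z mono[of x z] mono[of z x] by (cases x z rule: linorder_cases) (auto simp: digamma)
  qed
  moreover have "log_completely_monotonic_on (\<lambda>x. 1 / q_digamma q x) {z<..}"
  proof -
    define I where "I = {z<..}"
    have I: "open I" "I \<subseteq> {0<..}" using z by (auto simp: I_def)
    have \<psi>_pos: "0 < \<psi> x" if "x \<in> I" for x
      using that z mono[of z x] by (auto simp: I_def)
    have d: "(\<psi> has_real_derivative \<theta> x) (at x)" if "x \<in> I" for x
      using that I by (intro \<psi>) auto
    have cm\<theta>: "cm_upto n I \<theta>" for n
      using cm I(2) by (rule cm_upto_subset)
    have cm_inv: "cm_upto n I (\<lambda>x. 1 / \<psi> x)" for n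
      using \<psi>_pos d cm\<theta> by (rule cm_upto_inverse)
    have cm_log: "cm_upto n I (\<lambda>x. \<theta> x * (1 / \<psi> x))" for n
      by (intro cm_upto_mult cm\<theta> cm_inv)
    have eq: "1 / q_digamma q x = 1 * (1 / \<psi> x)" if "x \<in> I" for x
      using that I by (subst digamma) auto
    have ln_deriv: "deriv (\<lambda>t. ln (1 / q_digamma q t)) x = (- 1) * (\<theta> x * (1 / \<psi> x))"
      if "x \<in> I" for x
    proof -
      have "((\<lambda>t. ln (1 / \<psi> t)) has_real_derivative - (\<theta> x * (1 / \<psi> x))) (at x)"
        using d[OF that] \<psi>_pos[OF that] by (auto intro!: derivative_eq_intros simp: field_simps)
      then have "((\<lambda>t. ln (1 / q_digamma q t)) has_real_derivative - (\<theta> x * (1 / \<psi> x))) (at x)"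
        by (rule has_field_derivative_transform_within_open[OF _ I(1) that]) (simp add: eq)
      then show ?thesis by (simp add: DERIV_imp_deriv)
    qed
    have "0 \<le> (- 1) ^ n * (deriv ^^ n) (\<lambda>t. ln (1 / q_digamma q t)) x"
      if "1 \<le> n" "x \<in> I" for n x
    proof -
      obtain m where "n = Suc m" using \<open>1 \<le> n\<close> by (cases n) auto
      with cm_upto_iterated_deriv(1)[OF I(1) cm_log ln_deriv order_refl that(2), of m]
      show ?thesis by (simp add: funpow_Suc_right del: funpow.simps)
    qed
    moreover have "(deriv ^^ n) (\<lambda>x. 1 / q_digamma q x) differentiable (at x)" if "x \<in> I" for n x
      using cm_upto_iterated_deriv(2)[OF I(1) cm_inv[of "Suc n"] eq _ that, of n] by simp
    ultimately show ?thesis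
      unfolding log_completely_monotonic_on_def I_def[symmetric]
      using \<psi>_pos eq by simp
  qed
  ultimately show ?thesis by simp
qed

section \<open>Power series in an exponential\<close>

lemma summable_times_index:
  fixes c :: "nat \<Rightarrow> real"
  assumes "\<And>y. \<bar>y\<bar> < 1 \<Longrightarrow> summable (\<lambda>k. c k * y ^ k)" "\<bar>y\<bar> < 1"
  shows "(\<lambda>k. real k * c k * y ^ k) sums (y * (\<Sum>k. diffs c k * y ^ k))"
proof -
  have "summable (\<lambda>k. diffs c k * y ^ k)"
    using assms by (intro termdiff_converges[of y 1]) auto
  from sums_mult[OF diffs_equiv[OF this], of y]
  have "(\<lambda>k. y * (real k * c k * y ^ (k - Suc 0))) sums (y * (\<Sum>k. diffs c k * y ^ k))" .
  moreover have "y * (real k * c k * y ^ (k - Suc 0)) = real k * c k * y ^ k" for k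
    by (cases k) auto
  ultimately show ?thesis by simp
qed

lemma DERIV_exp_series:
  fixes c :: "nat \<Rightarrow> real"
  assumes p: "0 < p" "p < 1" and c: "\<And>y. \<bar>y\<bar> < 1 \<Longrightarrow> summable (\<lambda>k. c k * y ^ k)" and "0 < x"
  shows "((\<lambda>x. \<Sum>k. c k * (p powr x) ^ k) has_real_derivative
    ln p * (\<Sum>k. real k * c k * (p powr x) ^ k)) (at x)"
proof -
  have y: "0 < p powr x" "p powr x < 1" using p \<open>0 < x\<close> by (auto simp: powr01_less_one)
  obtain K where K: "p powr x < K" "K < 1" using dense y(2) by blast
  have "0 < K" using y(1) K(1) by (rule less_trans)
  have "((\<lambda>y. \<Sum>k. c k * y ^ k) has_real_derivative (\<Sum>k. diffs c k * (p powr x) ^ k))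
      (at (p powr x))"
    using y K \<open>0 < K\<close> by (intro termdiffs_strong[of c K] c) simp_all
  moreover have "((\<lambda>x. p powr x) has_real_derivative p powr x * ln p) (at x)"
    using p by (auto intro!: derivative_eq_intros)
  ultimately have "((\<lambda>x. \<Sum>k. c k * (p powr x) ^ k) has_real_derivative
      (\<Sum>k. diffs c k * (p powr x) ^ k) * (p powr x * ln p)) (at x)"
    by (rule DERIV_chain2)
  moreover have "(\<Sum>k. real k * c k * (p powr x) ^ k) = p powr x * (\<Sum>k. diffs c k * (p powr x) ^ k)"
    using summable_times_index[OF c, of "p powr x"] y by (auto simp: sums_iff)
  ultimately show ?thesis by (simp add: mult_ac)
qed

text \<open>
  Since \<open>ln p < 0\<close>, minus the derivative is again a series of this kind with nonnegative
  coefficients; hence the induction over all coefficient sequences at once.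
\<close>

lemma cm_upto_exp_series:
  fixes c :: "nat \<Rightarrow> real"
  assumes p: "0 < p" "p < 1"
    and "\<And>y. \<bar>y\<bar> < 1 \<Longrightarrow> summable (\<lambda>k. c k * y ^ k)" "\<And>k. 0 \<le> c k"
  shows "cm_upto n {0<..} (\<lambda>x. \<Sum>k. c k * (p powr x) ^ k)"
  using assms(3,4)
proof (induction n arbitrary: c)
  case 0
  then show ?case using p by (auto intro!: suminf_nonneg simp: powr01_less_one)
next
  case (Suc n)
  define d where "d = (\<lambda>k. - ln p * (real k * c k))"
  have sums: "summable (\<lambda>k. real k * c k * y ^ k)" if "\<bar>y\<bar> < 1" for y
    using summable_times_index[OF Suc.prems(1) that] by (auto simp: sums_iff)
  have "summable (\<lambda>k. d k * y ^ k)" if "\<bar>y\<bar> < 1" for y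
    using summable_mult[OF sums[OF that], of "- ln p"] by (simp add: d_def mult_ac)
  then have "cm_upto n {0<..} (\<lambda>x. \<Sum>k. d k * (p powr x) ^ k)"
    using Suc.prems(2) p by (intro Suc.IH) (auto simp: d_def mult_nonpos_nonneg)
  moreover have "((\<lambda>x. \<Sum>k. c k * (p powr x) ^ k) has_real_derivative
      - (\<Sum>k. d k * (p powr x) ^ k)) (at x)" if "0 < x" for x
  proof -
    have "(\<Sum>k. d k * (p powr x) ^ k) = - ln p * (\<Sum>k. real k * c k * (p powr x) ^ k)"
      using suminf_mult[OF sums, of "p powr x" "- ln p"] that p
      by (simp add: d_def powr01_less_one mult_ac)
    then show ?thesis using DERIV_exp_series[OF p Suc.prems(1) that] by simp
  qed
  moreover have "0 \<le> (\<Sum>k. c k * (p powr x) ^ k)" if "0 < x" for x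
    using Suc.prems that p by (auto intro!: suminf_nonneg simp: powr01_less_one)
  ultimately show ?case by (auto intro!: exI[of _ "\<lambda>x. \<Sum>k. d k * (p powr x) ^ k"])
qed

section \<open>The infinite product\<close>

text \<open>
  The series defined by these coefficients is \<open>- ln (\<Prod>j. 1 - p ^ j * y)\<close>, minus the logarithm of a
  \<open>q\<close>-Pochhammer symbol with base \<open>p\<close>: expand every factor and sum the geometric series over \<open>j\<close>.
  There is no constant term, in agreement with \<open>1 / 0 = 0\<close>.
\<close>

definition lambert_coeff :: "real \<Rightarrow> nat \<Rightarrow> real" where
  "lambert_coeff p k = 1 / (real k * (1 - p ^ k))"

definition lambert_series :: "real \<Rightarrow> real \<Rightarrow> real" where
  "lambert_series p y = (\<Sum>k. lambert_coeff p k * y ^ k)"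

context
  fixes p :: real
  assumes p: "0 < p" "p < 1"
begin

lemma lambert_coeff_nonneg: "0 \<le> lambert_coeff p k"
  using p by (simp add: lambert_coeff_def power_le_one)

lemma lambert_coeff_le: "lambert_coeff p k \<le> 1 / (1 - p)"
proof (cases k)
  case (Suc m)
  have "p ^ k \<le> p" using p Suc power_decreasing[of 1 k p] by simp
  then have "1 * (1 - p) \<le> real k * (1 - p ^ k)"
    using p Suc by (intro mult_mono) auto
  then show ?thesis
    unfolding lambert_coeff_def using p by (intro divide_left_mono) (auto intro: mult_pos_pos less_le_trans)
qed (use p in \<open>simp add: lambert_coeff_def\<close>)

lemma summable_lambert:
  assumes "\<bar>y\<bar> < 1"
  shows "summable (\<lambda>k. lambert_coeff p k * y ^ k)"
proof (rule summable_comparison_test)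
  show "summable (\<lambda>k. 1 / (1 - p) * \<bar>y\<bar> ^ k)"
    using assms by (intro summable_mult summable_geometric) auto
  show "\<exists>N. \<forall>k\<ge>N. norm (lambert_coeff p k * y ^ k) \<le> 1 / (1 - p) * \<bar>y\<bar> ^ k"
    using lambert_coeff_nonneg lambert_coeff_le
    by (intro exI allI impI) (simp add: abs_mult power_abs mult_right_mono del: times_divide_eq_left)
qed

text \<open>
  Subtracting \<open>p ^ k * y ^ k\<close> from \<open>y ^ k\<close> cancels the factor \<open>1 - p ^ k\<close> in the denominator of the
  \<open>k\<close>-th coefficient and leaves the logarithmic series.
\<close>

lemma lambert_series_shift:
  assumes "0 < y" "y < 1"
  shows "lambert_series p (p * y) = lambert_series p y + ln (1 - y)"
proof -
  have py: "\<bar>p * y\<bar> < 1" using p assms mult_strict_mono[of p 1 y 1] by (simp add: abs_mult)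
  have "(\<lambda>k. lambert_coeff p k * (p * y) ^ k - lambert_coeff p k * y ^ k) sums
      (lambert_series p (p * y) - lambert_series p y)"
    unfolding lambert_series_def using assms py
    by (intro sums_diff summable_sums summable_lambert) auto
  moreover have "lambert_coeff p k * (p * y) ^ k - lambert_coeff p k * y ^ k
      = - ((- (- y)) ^ k) / real k" for k
  proof (cases "k = 0")
    case False
    then have "p ^ k < 1" using p by (simp add: power_less_one_iff)
    then show ?thesis
      using False by (simp add: lambert_coeff_def power_mult_distrib divide_simps) (simp add: algebra_simps)
  qed (simp add: lambert_coeff_def)
  ultimately have "(\<lambda>k. - ((- (- y)) ^ k) / real k) sums
      (lambert_series p (p * y) - lambert_series p y)" by simp
  from sums_unique2[OF this ln_series'[of "- y"]] assms show ?thesis by simp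
qed

lemma isCont_lambert_series_0: "isCont (lambert_series p) 0"
  unfolding lambert_series_def
  by (rule isCont_powser[of _ "1/2"]) (auto intro: summable_lambert)

lemma lambert_series_0: "lambert_series p 0 = 0"
  unfolding lambert_series_def by (subst powser_zero) (simp add: lambert_coeff_def)

text \<open>
  By \<open>lambert_series_shift\<close> each factor is the exponential of a difference of consecutive values of
  the series, so the product telescopes. As \<open>n\<close> grows the first value tends to that at \<open>0\<close>, which
  gives the infinite product without interchanging the sums over \<open>j\<close> and \<open>k\<close>.
\<close>

lemma partial_q_product:
  assumes "0 < x"
  shows "(\<Prod>j<n. 1 - p powr (real j + x)) =
    exp (lambert_series p (p powr (real n + x)) - lambert_series p (p powr x))"
proof (induction n)
  case (Suc n)
  define y where "y = p powr (real n + x)"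
  have y: "0 < y" "y < 1" using p assms by (auto simp: y_def powr01_less_one)
  have "p powr (real (Suc n) + x) = p * y"
    using p by (simp add: y_def powr_add)
  then have "lambert_series p (p powr (real (Suc n) + x)) = lambert_series p y + ln (1 - y)"
    using lambert_series_shift[OF y] by simp
  then show ?case
    using y Suc.IH by (simp add: y_def[symmetric] exp_add exp_diff)
qed simp

lemma q_product:
  assumes "0 < x"
  shows "(\<Prod>j. (1 - p powr (real j + 1)) / (1 - p powr (real j + x))) =
    exp (lambert_series p (p powr x) - lambert_series p p)"
proof -
  let ?f = "\<lambda>j. (1 - p powr (real j + 1)) / (1 - p powr (real j + x))"
  have lim: "(\<lambda>n. lambert_series p (p powr (real n + u))) \<longlonglongrightarrow> 0" for u
  proof -
    have "(\<lambda>n. p ^ n * p powr u) \<longlonglongrightarrow> 0 * p powr u"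
      using p by (intro tendsto_intros LIMSEQ_realpow_zero) auto
    then have "(\<lambda>n. p powr (real n + u)) \<longlonglongrightarrow> 0"
      using p by (simp add: powr_add powr_realpow)
    from isCont_tendsto_compose[OF isCont_lambert_series_0 this] show ?thesis
      by (simp add: lambert_series_0)
  qed
  have "(\<lambda>n. \<Prod>j<n. ?f j) =
      (\<lambda>n. exp (lambert_series p (p powr (real n + 1)) - lambert_series p p) /
           exp (lambert_series p (p powr (real n + x)) - lambert_series p (p powr x)))"
    using p by (auto simp: prod_dividef partial_q_product[OF assms] partial_q_product[of 1])
  also have "\<dots> \<longlonglongrightarrow> exp (0 - lambert_series p p) / exp (0 - lambert_series p (p powr x))"
    by (intro tendsto_intros lim) auto
  finally have "(\<lambda>n. \<Prod>j<n. ?f j) \<longlonglongrightarrow> exp (lambert_series p (p powr x) - lambert_series p p)"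
    by (simp add: exp_diff exp_minus field_simps)
  then have "(\<lambda>n. \<Prod>j\<le>n. ?f j) \<longlonglongrightarrow> exp (lambert_series p (p powr x) - lambert_series p p)"
    by (subst (asm) LIMSEQ_lessThan_iff_atMost)
  then have "raw_has_prod ?f 0 (exp (lambert_series p (p powr x) - lambert_series p p))"
    by (simp add: raw_has_prod_def)
  then have "?f has_prod exp (lambert_series p (p powr x) - lambert_series p p)"
    by (simp add: has_prod_def)
  then show ?thesis by (rule has_prod_unique[symmetric])
qed

text \<open>
  The shape common to the cases \<open>q < 1\<close> and \<open>q > 1\<close>: there \<open>(a, b) = (ln (1 - q), 0)\<close> and
  \<open>(a, b) = (ln (q - 1), ln q)\<close>. The hypothesis \<open>a - b = ln (1 - p)\<close> says that \<open>\<Gamma>\<^sub>q\<close> takes the value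
  \<open>1\<close> at \<open>2\<close>, as it does at \<open>1\<close>.
\<close>

lemma log_cm_inverse_digamma_of_product:
  assumes Gamma: "\<And>x. 0 < x \<Longrightarrow> q_Gamma q x =
      exp (a * (1 - x) + b * (x * (x - 1) / 2) + (lambert_series p (p powr x) - lambert_series p p))"
    and "0 \<le> b" and ab: "a - b = ln (1 - p)"
  shows "log_completely_monotonic_on (\<lambda>x. 1 / q_digamma q x) {q_digamma_zero q<..}"
proof -
  define c1 where "c1 = (\<lambda>k. real k * lambert_coeff p k)"
  define c2 where "c2 = (\<lambda>k. real k * c1 k)"
  define \<psi> where "\<psi> = (\<lambda>x. - a + b * (x - 1 / 2) + ln p * (\<Sum>k. c1 k * (p powr x) ^ k))"
  define \<theta> where "\<theta> = (\<lambda>x. b + (ln p * ln p) * (\<Sum>k. c2 k * (p powr x) ^ k))"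
  have c1: "summable (\<lambda>k. c1 k * y ^ k)" if "\<bar>y\<bar> < 1" for y
    using summable_times_index[OF summable_lambert that] by (auto simp: sums_iff c1_def)
  have c2: "summable (\<lambda>k. c2 k * y ^ k)" if "\<bar>y\<bar> < 1" for y
    using summable_times_index[OF c1 that] by (auto simp: sums_iff c2_def)
  have c2_nonneg: "0 \<le> c2 k" for k
    by (simp add: c2_def c1_def lambert_coeff_nonneg)
  show ?thesis
  proof (rule log_cm_inverse_digamma)
    fix x :: real assume "0 < x"
    have x: "\<bar>p powr x\<bar> < 1" using p \<open>0 < x\<close> by (simp add: powr01_less_one)
    show "q_Gamma q x = exp (a * (1 - x) + b * (x * (x - 1) / 2) +
        (lambert_series p (p powr x) - lambert_series p p))"
      using \<open>0 < x\<close> by (rule Gamma)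
    have "((\<lambda>x. lambert_series p (p powr x)) has_real_derivative
        ln p * (\<Sum>k. c1 k * (p powr x) ^ k)) (at x)"
      unfolding lambert_series_def c1_def
      using p summable_lambert \<open>0 < x\<close> by (rule DERIV_exp_series)
    then show "((\<lambda>x. a * (1 - x) + b * (x * (x - 1) / 2) +
        (lambert_series p (p powr x) - lambert_series p p)) has_real_derivative \<psi> x) (at x)"
      unfolding \<psi>_def by (auto intro!: derivative_eq_intros simp: field_simps)
    have "((\<lambda>x. \<Sum>k. c1 k * (p powr x) ^ k) has_real_derivative
        ln p * (\<Sum>k. c2 k * (p powr x) ^ k)) (at x)"
      unfolding c2_def using p c1 \<open>0 < x\<close> by (rule DERIV_exp_series)
    then show "(\<psi> has_real_derivative \<theta> x) (at x)"
      unfolding \<psi>_def \<theta>_def by (auto intro!: derivative_eq_intros)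
    have "0 < (\<Sum>k. c2 k * (p powr x) ^ k)"
      using c2[OF x] p
      by (intro suminf_pos2[where i = 1]) (auto simp: c2_nonneg c2_def c1_def lambert_coeff_def power_le_one)
    moreover have "0 < ln p * ln p" using p by (simp add: mult_neg_neg)
    ultimately show "0 < \<theta> x"
      using \<open>0 \<le> b\<close> unfolding \<theta>_def by (simp add: add_nonneg_pos)
  next
    show "cm_upto n {0<..} \<theta>" for n
      unfolding \<theta>_def using p c2 c2_nonneg \<open>0 \<le> b\<close>
      by (intro cm_upto_add cm_upto_mult cm_upto_const cm_upto_exp_series) auto
  next
    have "p powr 2 = p * p" using p by (simp add: powr_numeral power2_eq_square)
    then show "a * (1 - 1) + b * (1 * (1 - 1) / 2) + (lambert_series p (p powr 1) - lambert_series p p)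
        = a * (1 - 2) + b * (2 * (2 - 1) / 2) + (lambert_series p (p powr 2) - lambert_series p p)"
      using p ab lambert_series_shift[of p] by simp
  qed
qed

end

section \<open>The three cases\<close>

lemma log_cm_inverse_digamma_lt_1:
  assumes "0 < q" "q < 1"
  shows "log_completely_monotonic_on (\<lambda>x. 1 / q_digamma q x) {q_digamma_zero q<..}"
proof (rule log_cm_inverse_digamma_of_product[OF assms, where a = "ln (1 - q)" and b = 0])
  fix x :: real assume "0 < x"
  then show "q_Gamma q x = exp (ln (1 - q) * (1 - x) + 0 * (x * (x - 1) / 2) +
      (lambert_series q (q powr x) - lambert_series q q))"
    using assms q_product[OF assms \<open>0 < x\<close>] by (simp add: q_Gamma_def exp_add powr_def mult_ac)
qed (use assms in auto)

lemma log_cm_inverse_digamma_gt_1: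
  assumes "1 < q"
  shows "log_completely_monotonic_on (\<lambda>x. 1 / q_digamma q x) {q_digamma_zero q<..}"
proof -
  define p where "p = 1 / q"
  have p: "0 < p" "p < 1" using assms by (auto simp: p_def)
  show ?thesis
  proof (rule log_cm_inverse_digamma_of_product[OF p, where a = "ln (q - 1)" and b = "ln q"])
    fix x :: real assume "0 < x"
    have "q powr (- u) = p powr u" for u
      using assms by (simp add: p_def powr_minus powr_divide inverse_eq_divide)
    then show "q_Gamma q x = exp (ln (q - 1) * (1 - x) + ln q * (x * (x - 1) / 2) +
        (lambert_series p (p powr x) - lambert_series p p))"
      using assms q_product[OF p \<open>0 < x\<close>]
      by (simp only: q_Gamma_def) (simp add: exp_add powr_def mult_ac)
  next
    have "1 - p = (q - 1) / q" using assms by (simp add: p_def field_simps)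
    then show "ln (q - 1) - ln q = ln (1 - p)" using assms by (simp add: ln_div)
  qed (use assms in auto)
qed

lemma cm_upto_Polygamma:
  assumes "1 \<le> m"
  shows "cm_upto n {0<..} (\<lambda>x::real. (- 1) ^ Suc m * Polygamma m x)"
  using assms
proof (induction n arbitrary: m)
  case 0
  then show ?case
    by (cases "even m") (auto intro!: Polygamma_real_odd_pos Polygamma_real_even_neg less_imp_le elim!: nonpos_Ints_cases)
next
  case (Suc n)
  have "0 \<le> (- 1) ^ Suc m * Polygamma m x" if "0 < x" for x :: real
    using Suc.prems that
    by (cases "even m") (auto intro!: Polygamma_real_odd_pos Polygamma_real_even_neg less_imp_le elim!: nonpos_Ints_cases)
  moreover have "((\<lambda>x. (- 1) ^ Suc m * Polygamma m x) has_real_derivative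
      - ((- 1) ^ Suc (Suc m) * Polygamma (Suc m) x)) (at x)" if "0 < x" for x :: real
    using that by (auto intro!: derivative_eq_intros)
  ultimately show ?case
    using Suc.IH[of "Suc m"]
    by (auto intro!: exI[of _ "\<lambda>x. (- 1) ^ Suc (Suc m) * Polygamma (Suc m) x"] simp del: power_Suc)
qed

lemma log_cm_inverse_digamma_1:
  "log_completely_monotonic_on (\<lambda>x. 1 / q_digamma 1 x) {q_digamma_zero 1<..}"
proof (rule log_cm_inverse_digamma)
  fix x :: real assume "0 < x"
  then show "q_Gamma 1 x = exp (ln_Gamma x)"
    by (simp add: q_Gamma_def Gamma_real_pos_exp)
  show "(ln_Gamma has_real_derivative Digamma x) (at x)"
    using \<open>0 < x\<close> by (rule has_field_derivative_ln_Gamma_real)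
  show "(Digamma has_real_derivative Polygamma 1 x) (at x)"
    using \<open>0 < x\<close> by (auto intro!: derivative_eq_intros)
  show "0 < Polygamma 1 x"
    using \<open>0 < x\<close> by (intro Polygamma_real_odd_pos) (auto elim!: nonpos_Ints_cases)
next
  show "cm_upto n {0<..} (Polygamma 1 :: real \<Rightarrow> real)" for n
    using cm_upto_Polygamma[of 1 n] by simp
  show "ln_Gamma 1 = (ln_Gamma 2 :: real)"
    using Gamma_fact[of 1, where 'a = real] by (simp add: ln_Gamma_real_pos)
qed

theorem theorem3:
  fixes q :: real
  assumes "q > 0"
  shows "log_completely_monotonic_on (\<lambda>x. 1 / q_digamma q x) {q_digamma_zero q<..}"
  using assms log_cm_inverse_digamma_lt_1 log_cm_inverse_digamma_1 log_cm_inverse_digamma_gt_1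
  by (cases q "1 :: real" rule: linorder_cases) auto

end
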